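(* Let $R$ be a commutative ring with identity that is not an integral domain. If $\mathbb{AG}_N(R)$ is an $r$-regular graph for some non-negative integer $r$, then $\mathbb{AG}_N(R)$ is a complete graph.
   Context: All rings are commutative with identity $1\neq 0$. ${\rm Nil}(R)$ is the nilradical of $R$. An ideal is non-trivial if it is nonzero and proper. The nil-graph of ideals $\mathbb{AG}_N(R)$ is the simple graph whose vertices are the nonzero proper ideals $I$ of $R$ for which there exists a non-trivial ideal $J$ of $R$ with $IJ\subseteq {\rm Nil}(R)$; two distinct vertices $I,J$ are adjacent if and only if $IJ\subseteq {\rm Nil}(R)$. A graph is $r$-regular if every vertex has degree $r$ ($r$ finite), and complete if any two distinct vertices are adjacent. *)

theory Defs
  imports
    "HOL-Algebra.Ring"
    "HOL-Algebra.Ideal"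
    "HOL-Algebra.Ideal_Product"
    "Graph_Theory.Digraph"
    "Graph_Theory.Pair_Digraph"
begin

definition nilradical :: "('a, 'b) ring_scheme \<Rightarrow> 'a set" where
  "nilradical R = {x \<in> carrier R. \<exists>n::nat. x [^]\<^bsub>R\<^esub> n = \<zero>\<^bsub>R\<^esub>}"

definition nontrivial_ideal :: "'a set \<Rightarrow> ('a, 'b) ring_scheme \<Rightarrow> bool" where
  "nontrivial_ideal I R \<longleftrightarrow> ideal I R \<and> I \<noteq> {\<zero>\<^bsub>R\<^esub>} \<and> I \<noteq> carrier R"

definition nil_vertices :: "('a, 'b) ring_scheme \<Rightarrow> 'a set set" where
  "nil_vertices R = {I. nontrivial_ideal I R \<and>
     (\<exists>J. nontrivial_ideal J R \<and> I \<cdot>\<^bsub>R\<^esub> J \<subseteq> nilradical R)}"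

text \<open>A simple graph, possibly infinite, is encoded as a loop-free symmetric digraph: an edge
  between \<open>I\<close> and \<open>J\<close> is the pair of arcs \<open>(I, J)\<close> and \<open>(J, I)\<close>.\<close>

definition nil_graph :: "('a, 'b) ring_scheme \<Rightarrow> 'a set pair_pre_digraph" where
  "nil_graph R = \<lparr> pverts = nil_vertices R,
     parcs = {(I, J). I \<in> nil_vertices R \<and> J \<in> nil_vertices R \<and> I \<noteq> J \<and>
                      I \<cdot>\<^bsub>R\<^esub> J \<subseteq> nilradical R} \<rparr>"

lemma nil_graph_loopfree: "pair_loopfree_digraph (nil_graph R)"
  by unfold_locales (auto simp: nil_graph_def)

lemma nil_graph_symmetric: "cring R \<Longrightarrow> symmetric (nil_graph R)"
  by (auto simp: symmetric_def sym_def nil_graph_def arcs_ends_def arc_to_ends_def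
      nil_vertices_def nontrivial_ideal_def cring.ideal_prod_commute)

text \<open>In a symmetric digraph the degree of a vertex in the underlying simple graph is its
  out-degree. Finiteness is required separately because \<^const>\<open>card\<close> of an infinite set is \<open>0\<close>.\<close>

definition regular_graph :: "nat \<Rightarrow> ('v, 'e) pre_digraph \<Rightarrow> bool" where
  "regular_graph r G \<longleftrightarrow> (\<forall>v \<in> verts G. finite (out_arcs G v) \<and> out_degree G v = r)"

text \<open>The finite case is \<open>complete_digraph\<close> in \<open>Graph_Theory.Kuratowski\<close>.\<close>

definition complete_graph :: "('v, 'e) pre_digraph \<Rightarrow> bool" where
  "complete_graph G \<longleftrightarrow> (\<forall>u \<in> verts G. \<forall>v \<in> verts G. u \<noteq> v \<longrightarrow> u \<rightarrow>\<^bsub>G\<^esub> v)"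

end

theory Submission
  imports Defs
begin

text \<open>
  The proof distinguishes whether the ring has nonzero nilpotent elements.

  If \<open>a\<close> is a nonzero nilpotent element, then every multiple of \<open>a\<close> is nilpotent, so the principal
  ideal of \<open>a\<close> is a vertex adjacent to all the others. Its degree is one less than the number of
  vertices, by regularity so is every degree, and the graph is complete.

  In a reduced ring, adjacency of \<open>I\<close> and \<open>J\<close> means \<open>I \<cdot> J = {\<zero>}\<close>, and passing to a smaller nonzero
  ideal can only enlarge the neighbourhood (\<open>nil_neighbours_antimono\<close>). Neighbourhoods are finite and
  of equal size, hence they do not change at all; so each nonzero \<open>x \<in> I\<close> has the same annihilator as
  the whole ideal \<open>I\<close> (\<open>annihilator_of_element_annihilates_vertex\<close>). Finiteness also bounds the number
  of principal ideals generated by powers of \<open>x\<close>, which makes \<open>x\<close> von Neumann regular,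
  \<open>x = x\<^sup>2 y\<close> (\<open>element_of_vertex_regular\<close>). Now \<open>\<one> - x y\<close> annihilates \<open>x\<close>, hence \<open>I\<close>, and therefore
  \<open>I\<close> is generated by \<open>x\<close>. Every vertex is thus generated by any one of its nonzero elements, so two
  distinct vertices intersect trivially and have product zero.
\<close>

section \<open>Neighbourhoods in the nil-graph\<close>

definition nil_neighbours :: "('a, 'b) ring_scheme \<Rightarrow> 'a set \<Rightarrow> 'a set set" where
  "nil_neighbours R I = {J \<in> nil_vertices R. J \<noteq> I \<and> I \<cdot>\<^bsub>R\<^esub> J \<subseteq> nilradical R}"

lemma out_arcs_nil_graph:
  assumes "I \<in> nil_vertices R"
  shows "out_arcs (with_proj (nil_graph R)) I = Pair I ` nil_neighbours R I"
  using assms by (auto simp: out_arcs_def nil_graph_def nil_neighbours_def)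

lemma regular_nil_graphD:
  assumes "regular_graph r (with_proj (nil_graph R))" and "I \<in> nil_vertices R"
  shows "finite (nil_neighbours R I)" and "card (nil_neighbours R I) = r"
proof -
  have inj: "inj_on (Pair I) (nil_neighbours R I)"
    by (simp add: inj_on_def)
  have deg: "finite (Pair I ` nil_neighbours R I)" "card (Pair I ` nil_neighbours R I) = r"
    using assms out_arcs_nil_graph[OF assms(2)]
    by (auto simp: regular_graph_def out_degree_def nil_graph_def)
  show "finite (nil_neighbours R I)"
    using deg(1) inj by (rule finite_imageD)
  show "card (nil_neighbours R I) = r"
    using deg(2) card_image[OF inj] by simp
qed

lemma complete_nil_graphI:
  assumes "\<And>I J. I \<in> nil_vertices R \<Longrightarrow> J \<in> nil_vertices R \<Longrightarrow> I \<noteq> J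
    \<Longrightarrow> I \<cdot>\<^bsub>R\<^esub> J \<subseteq> nilradical R"
  shows "complete_graph (with_proj (nil_graph R))"
  using assms by (auto simp: complete_graph_def nil_graph_def)

lemma nil_verticesD:
  assumes "I \<in> nil_vertices R"
  shows "ideal I R" and "I \<noteq> {\<zero>\<^bsub>R\<^esub>}" and "I \<noteq> carrier R"
  using assms by (auto simp: nil_vertices_def nontrivial_ideal_def)

lemma ideal_prod_mono:
  assumes "I \<subseteq> I'" and "J \<subseteq> J'"
  shows "I \<cdot>\<^bsub>R\<^esub> J \<subseteq> I' \<cdot>\<^bsub>R\<^esub> J'"
proof
  fix s assume "s \<in> I \<cdot>\<^bsub>R\<^esub> J"
  then show "s \<in> I' \<cdot>\<^bsub>R\<^esub> J'"
    by induction (use assms in \<open>auto intro: ideal_prod.intros\<close>)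
qed

lemma nonzero_subideal_of_vertex:
  assumes "I \<in> nil_vertices R" and "ideal K R" and "K \<subseteq> I" and "K \<noteq> {\<zero>\<^bsub>R\<^esub>}"
  shows "K \<in> nil_vertices R"
proof -
  obtain J where J: "nontrivial_ideal J R" "I \<cdot>\<^bsub>R\<^esub> J \<subseteq> nilradical R"
    using assms(1) by (auto simp: nil_vertices_def)
  have "I \<subseteq> carrier R" "I \<noteq> carrier R"
    using nil_verticesD[OF assms(1)] by (auto dest: ideal.Icarr)
  then have "nontrivial_ideal K R"
    using assms by (auto simp: nontrivial_ideal_def)
  moreover have "K \<cdot>\<^bsub>R\<^esub> J \<subseteq> nilradical R"
    using ideal_prod_mono[OF assms(3) subset_refl, of R J] J(2) by blast
  ultimately show ?thesis
    using J(1) by (auto simp: nil_vertices_def)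
qed

lemma (in ring) ideal_has_nonzero_element:
  assumes "ideal I R" and "I \<noteq> {\<zero>}"
  obtains x where "x \<in> I" and "x \<noteq> \<zero>"
  using assms additive_subgroup.zero_closed[OF ideal.axioms(1)[OF assms(1)]] by blast

lemma (in cring) PIdl_eq_zero_iff:
  assumes "x \<in> carrier R"
  shows "PIdl x = {\<zero>} \<longleftrightarrow> x = \<zero>"
  using cgenideal_self[OF assms] by (auto simp: cgenideal_def)

section \<open>Rings with nonzero nilpotent elements\<close>

text \<open>A vertex adjacent to all the others has the largest degree that any vertex could have;
  regularity forces this degree on every vertex.\<close>

lemma complete_if_dominating_vertex:
  assumes reg: "regular_graph r (with_proj (nil_graph R))"
    and K: "K \<in> nil_vertices R"
    and dom: "\<And>J. J \<in> nil_vertices R \<Longrightarrow> K \<cdot>\<^bsub>R\<^esub> J \<subseteq> nilradical R"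
  shows "complete_graph (with_proj (nil_graph R))"
proof (rule complete_nil_graphI)
  fix I J assume IJ: "I \<in> nil_vertices R" "J \<in> nil_vertices R" "I \<noteq> J"
  have nbK: "nil_neighbours R K = nil_vertices R - {K}"
    using dom by (auto simp: nil_neighbours_def)
  have fin: "finite (nil_vertices R)"
    using regular_nil_graphD(1)[OF reg K] unfolding nbK by simp
  have sub: "nil_neighbours R I \<subseteq> nil_vertices R - {I}"
    by (auto simp: nil_neighbours_def)
  have "card (nil_neighbours R I) = card (nil_neighbours R K)"
    using regular_nil_graphD(2)[OF reg] IJ(1) K by simp
  also have "\<dots> = card (nil_vertices R - {I})"
    using fin IJ(1) K by (simp add: nbK)
  finally have "nil_neighbours R I = nil_vertices R - {I}"
    using fin sub by (simp add: card_subset_eq)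
  then show "I \<cdot>\<^bsub>R\<^esub> J \<subseteq> nilradical R"
    using IJ by (auto simp: nil_neighbours_def)
qed

lemma (in cring) PIdl_nilpotent_subset_nilradical:
  assumes "a \<in> nilradical R"
  shows "PIdl a \<subseteq> nilradical R"
proof
  fix b assume "b \<in> PIdl a"
  then obtain c where c: "c \<in> carrier R" "b = c \<otimes> a"
    by (auto simp: cgenideal_def)
  obtain n :: nat where n: "a [^] n = \<zero>" and a: "a \<in> carrier R"
    using assms by (auto simp: nilradical_def)
  have "b [^] n = \<zero>"
    using c a n by (simp add: nat_pow_distrib)
  then show "b \<in> nilradical R"
    using c a by (auto simp: nilradical_def)
qed

lemma (in cring) complete_if_not_reduced:
  assumes reg: "regular_graph r (with_proj (nil_graph R))"
    and one: "\<one> \<noteq> \<zero>"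
    and a: "a \<in> nilradical R" "a \<noteq> \<zero>"
  shows "complete_graph (with_proj (nil_graph R))"
proof (rule complete_if_dominating_vertex[OF reg])
  let ?K = "PIdl a"
  have ac: "a \<in> carrier R"
    using a by (simp add: nilradical_def)
  have K: "ideal ?K R"
    using ac by (rule cgenideal_ideal)
  have adj: "?K \<cdot> J \<subseteq> nilradical R" if "ideal J R" for J
    using ideal_prod_inter[OF K that] PIdl_nilpotent_subset_nilradical[OF a(1)] by blast
  have "\<one> \<notin> ?K"
    using PIdl_nilpotent_subset_nilradical[OF a(1)] one by (auto simp: nilradical_def)
  then have "nontrivial_ideal ?K R"
    using K ac a(2) by (auto simp: nontrivial_ideal_def PIdl_eq_zero_iff)
  then show "?K \<in> nil_vertices R"
    using adj[OF K] by (auto simp: nil_vertices_def)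
  show "?K \<cdot> J \<subseteq> nilradical R" if "J \<in> nil_vertices R" for J
    using adj nil_verticesD(1)[OF that] .
qed

section \<open>Reduced rings\<close>

lemma (in cring) reduced_square_zero:
  assumes "nilradical R = {\<zero>}" and "x \<in> carrier R" and "x \<otimes> x = \<zero>"
  shows "x = \<zero>"
proof -
  have "x [^] (2::nat) = \<zero>"
    using assms by (simp add: numeral_2_eq_2)
  then have "x \<in> nilradical R"
    using assms(2) by (auto simp: nilradical_def)
  then show ?thesis
    using assms(1) by simp
qed

lemma (in cring) reduced_ideal_square_zero:
  assumes "nilradical R = {\<zero>}" and I: "ideal I R" and "I \<cdot> I \<subseteq> {\<zero>}"
  shows "I = {\<zero>}"
proof (rule ccontr)
  assume "I \<noteq> {\<zero>}"
  then obtain x where x: "x \<in> I" "x \<noteq> \<zero>"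
    using ideal_has_nonzero_element[OF I] by blast
  then have "x \<otimes> x = \<zero>"
    using assms(3) ideal_prod.prod[of x I x I R] by blast
  then show False
    using reduced_square_zero[OF assms(1)] ideal.Icarr[OF I x(1)] x(2) by blast
qed

text \<open>Reducedness enters because a neighbour of \<open>I\<close> might coincide with \<open>K\<close>, which is not its own
  neighbour; such a \<open>K\<close> would have square zero.\<close>

lemma (in cring) nil_neighbours_antimono:
  assumes red: "nilradical R = {\<zero>}"
    and K: "ideal K R" "K \<subseteq> I" "K \<noteq> {\<zero>}"
  shows "nil_neighbours R I \<subseteq> nil_neighbours R K"
proof
  fix J assume J: "J \<in> nil_neighbours R I"
  have prod: "K \<cdot> J \<subseteq> {\<zero>}"
    using ideal_prod_mono[OF K(2) subset_refl, of R J] J red by (auto simp: nil_neighbours_def)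
  have "J \<noteq> K"
    using reduced_ideal_square_zero[OF red K(1)] K(3) prod by blast
  then show "J \<in> nil_neighbours R K"
    using J prod red by (auto simp: nil_neighbours_def)
qed

lemma (in cring) nil_neighbours_eq_of_subideal:
  assumes red: "nilradical R = {\<zero>}"
    and reg: "regular_graph r (with_proj (nil_graph R))"
    and I: "I \<in> nil_vertices R"
    and K: "ideal K R" "K \<subseteq> I" "K \<noteq> {\<zero>}"
  shows "nil_neighbours R I = nil_neighbours R K"
proof (rule card_subset_eq)
  have "K \<in> nil_vertices R"
    using nonzero_subideal_of_vertex I K by blast
  then show "finite (nil_neighbours R K)"
    and "card (nil_neighbours R I) = card (nil_neighbours R K)"
    using regular_nil_graphD[OF reg] I by auto
qed (rule nil_neighbours_antimono[OF red K])

text \<open>If \<open>z\<close> annihilates \<open>x\<close>, then the principal ideal of \<open>z\<close> is a neighbour of that of \<open>x\<close>, hence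
  a neighbour of \<open>I\<close>.\<close>

lemma (in cring) annihilator_of_element_annihilates_vertex:
  assumes red: "nilradical R = {\<zero>}"
    and reg: "regular_graph r (with_proj (nil_graph R))"
    and I: "I \<in> nil_vertices R"
    and x: "x \<in> I" "x \<noteq> \<zero>"
    and z: "z \<in> carrier R" "x \<otimes> z = \<zero>"
    and w: "w \<in> I"
  shows "w \<otimes> z = \<zero>"
proof (cases "z = \<zero>")
  case True
  then show ?thesis
    using w nil_verticesD(1)[OF I] by (simp add: ideal.Icarr)
next
  case False
  have xc: "x \<in> carrier R"
    using nil_verticesD(1)[OF I] x(1) by (rule ideal.Icarr)
  have X: "ideal (PIdl x) R" "PIdl x \<subseteq> I" "PIdl x \<noteq> {\<zero>}"
    using xc x cgenideal_minimal[OF nil_verticesD(1)[OF I] x(1)]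
    by (auto simp: cgenideal_ideal PIdl_eq_zero_iff)
  have X_vertex: "PIdl x \<in> nil_vertices R"
    using nonzero_subideal_of_vertex[OF I X] .
  have Z: "ideal (PIdl z) R" "PIdl z \<noteq> {\<zero>}"
    using z(1) False by (auto simp: cgenideal_ideal PIdl_eq_zero_iff)
  have "\<one> \<notin> PIdl z"
  proof
    assume "\<one> \<in> PIdl z"
    then obtain c where c: "c \<in> carrier R" "\<one> = c \<otimes> z"
      by (auto simp: cgenideal_def)
    then have "x = c \<otimes> (x \<otimes> z)"
      using xc z(1) by (metis m_lcomm r_one)
    then show False
      using z(2) c(1) x(2) by simp
  qed
  then have Z_proper: "PIdl z \<noteq> carrier R"
    by auto
  have "(PIdl x) <#> (PIdl z) = PIdl (x \<otimes> z)"
    using xc z(1) by (rule cgenideal_prod)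
  then have elementwise: "i \<otimes> j = \<zero>" if "i \<in> PIdl x" "j \<in> PIdl z" for i j
    using that PIdl_eq_zero_iff[of \<zero>] z(2) by (auto simp: set_mult_def)
  have prod: "(PIdl x) \<cdot> (PIdl z) \<subseteq> {\<zero>}"
  proof
    fix s assume "s \<in> (PIdl x) \<cdot> (PIdl z)"
    then show "s \<in> {\<zero>}"
      by induction (auto simp: elementwise)
  qed
  have "PIdl z \<in> nil_vertices R"
    using Z Z_proper prod red ideal_prod_commute[OF X(1) Z(1)] nil_verticesD[OF X_vertex]
    by (auto simp: nil_vertices_def nontrivial_ideal_def)
  moreover have "PIdl z \<noteq> PIdl x"
    using reduced_ideal_square_zero[OF red X(1)] X(3) prod by auto
  ultimately have "PIdl z \<in> nil_neighbours R (PIdl x)"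
    using prod red by (auto simp: nil_neighbours_def)
  then have "PIdl z \<in> nil_neighbours R I"
    using nil_neighbours_eq_of_subideal[OF red reg I X] by simp
  then have "I \<cdot> (PIdl z) \<subseteq> {\<zero>}"
    using red by (simp add: nil_neighbours_def)
  then show ?thesis
    using ideal_prod.prod[OF w cgenideal_self[OF z(1)], of R] by blast
qed

text \<open>Two powers of \<open>x\<close> that generate the same ideal give \<open>x\<^sup>m (\<one> - x y) = \<zero>\<close>. Then \<open>x (\<one> - x y)\<close> is
  nilpotent, which in a reduced ring brings the exponent \<open>m\<close> down to one. The nilpotency is
  witnessed by the exponent \<open>m + 1\<close> because \<open>m\<close> may be zero.\<close>

lemma (in cring) reduced_regular_if_powers_finite:
  assumes red: "nilradical R = {\<zero>}"
    and x: "x \<in> carrier R"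
    and fin: "finite (range (\<lambda>n::nat. PIdl (x [^] n)))"
  obtains y where "y \<in> carrier R" and "x \<otimes> (\<one> \<ominus> x \<otimes> y) = \<zero>"
proof -
  have "\<not> inj (\<lambda>n::nat. PIdl (x [^] n))"
    using fin finite_imageD infinite_UNIV_nat by blast
  then obtain m n :: nat where mn: "m < n" and eq: "PIdl (x [^] m) = PIdl (x [^] n)"
    unfolding inj_def by (metis nat_neq_iff)
  obtain c where c: "c \<in> carrier R" "x [^] m = c \<otimes> x [^] n"
    using cgenideal_self[of "x [^] m"] x eq by (auto simp: cgenideal_def)
  define y where "y = c \<otimes> x [^] (n - Suc m)"
  define u where "u = \<one> \<ominus> x \<otimes> y"
  have y: "y \<in> carrier R" and u: "u \<in> carrier R"
    using c(1) x by (auto simp: y_def u_def)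
  have "x [^] n = x [^] (n - Suc m) \<otimes> (x [^] m \<otimes> x)"
    using x mn nat_pow_mult[of x "n - Suc m" "Suc m"] by simp
  then have "x [^] m = x [^] m \<otimes> (x \<otimes> y)"
    using c x by (simp add: y_def m_ac)
  then have "x [^] m \<otimes> u = \<zero>"
    using x y by (simp add: u_def minus_eq r_distr r_minus r_neg)
  moreover have "(x \<otimes> u) [^] Suc m = (x [^] m \<otimes> u) \<otimes> (x \<otimes> u [^] m)"
    using x u by (simp add: nat_pow_distrib m_ac)
  ultimately have "(x \<otimes> u) [^] Suc m = \<zero>"
    using x u by simp
  then have "x \<otimes> u \<in> nilradical R"
    using x u unfolding nilradical_def by blast
  then show thesis
    using that[OF y] red by (simp add: u_def)
qed

text \<open>A neighbour \<open>J\<close> of \<open>I\<close> has every nonzero ideal inside \<open>I\<close> as a neighbour. Since \<open>J\<close> has finite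
  degree, \<open>I\<close> contains only finitely many ideals, and the positive powers of \<open>x\<close> lie in \<open>I\<close>.\<close>

lemma (in cring) element_of_vertex_regular:
  assumes red: "nilradical R = {\<zero>}"
    and reg: "regular_graph r (with_proj (nil_graph R))"
    and I: "I \<in> nil_vertices R"
    and x: "x \<in> I"
  obtains y where "y \<in> carrier R" and "x \<otimes> (\<one> \<ominus> x \<otimes> y) = \<zero>"
proof -
  have II: "ideal I R"
    using nil_verticesD(1)[OF I] .
  have xc: "x \<in> carrier R"
    using II x by (rule ideal.Icarr)
  obtain J where J: "nontrivial_ideal J R" "I \<cdot> J \<subseteq> {\<zero>}"
    using I red by (auto simp: nil_vertices_def)
  have JI: "J \<cdot> I \<subseteq> {\<zero>}"
    using J ideal_prod_commute[OF II, of J] by (simp add: nontrivial_ideal_def)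
  have J_vertex: "J \<in> nil_vertices R"
    using J(1) JI I red by (auto simp: nil_vertices_def)
  have JJ: "ideal J R" "J \<noteq> {\<zero>}"
    using J(1) by (auto simp: nontrivial_ideal_def)
  have subideals: "K \<in> insert {\<zero>} (nil_neighbours R J)" if K: "ideal K R" "K \<subseteq> I" for K
  proof (cases "K = {\<zero>}")
    case False
    have JK: "J \<cdot> K \<subseteq> {\<zero>}"
      using ideal_prod_mono[OF subset_refl K(2), of R J] JI by blast
    have "K \<noteq> J"
      using JK reduced_ideal_square_zero[OF red JJ(1)] JJ(2) by blast
    then show ?thesis
      using nonzero_subideal_of_vertex[OF I K False] JK red by (auto simp: nil_neighbours_def)
  qed simp
  have "PIdl (x [^] n) \<in> insert (PIdl \<one>) (insert {\<zero>} (nil_neighbours R J))" for n :: nat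
  proof (cases n)
    case (Suc k)
    then have "x [^] n \<in> I"
      using x xc II by (simp add: ideal.I_l_closed)
    then have "PIdl (x [^] n) \<in> insert {\<zero>} (nil_neighbours R J)"
      using subideals cgenideal_ideal cgenideal_minimal[OF II] xc by simp
    then show ?thesis
      by (rule insertI2)
  qed simp
  then have "range (\<lambda>n::nat. PIdl (x [^] n)) \<subseteq> insert (PIdl \<one>) (insert {\<zero>} (nil_neighbours R J))"
    by blast
  then have "finite (range (\<lambda>n::nat. PIdl (x [^] n)))"
    using regular_nil_graphD(1)[OF reg J_vertex] by (meson finite.insertI finite_subset)
  then show thesis
    using reduced_regular_if_powers_finite[OF red xc] that by blast
qed

text \<open>With \<open>x = x\<^sup>2 y\<close>, the element \<open>\<one> - x y\<close> annihilates \<open>x\<close> and therefore \<open>I\<close>, so that the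
  idempotent \<open>x y\<close> acts on \<open>I\<close> as the identity.\<close>

lemma (in cring) vertex_generated_by_nonzero_element:
  assumes red: "nilradical R = {\<zero>}"
    and reg: "regular_graph r (with_proj (nil_graph R))"
    and I: "I \<in> nil_vertices R"
    and x: "x \<in> I" "x \<noteq> \<zero>"
  shows "I = PIdl x"
proof
  have II: "ideal I R"
    using nil_verticesD(1)[OF I] .
  have xc: "x \<in> carrier R"
    using II x(1) by (rule ideal.Icarr)
  show "PIdl x \<subseteq> I"
    using cgenideal_minimal[OF II x(1)] .
  obtain y where y: "y \<in> carrier R" "x \<otimes> (\<one> \<ominus> x \<otimes> y) = \<zero>"
    using element_of_vertex_regular[OF red reg I x(1)] .
  show "I \<subseteq> PIdl x"
  proof
    fix w assume w: "w \<in> I"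
    have wc: "w \<in> carrier R"
      using II w by (rule ideal.Icarr)
    have "w \<otimes> (\<one> \<ominus> x \<otimes> y) = \<zero>"
      using annihilator_of_element_annihilates_vertex[OF red reg I x _ y(2) w] xc y(1) by simp
    then have "w \<oplus> \<ominus> (w \<otimes> (x \<otimes> y)) = \<zero>"
      using wc xc y(1) by (simp add: minus_eq r_distr r_minus)
    then have "w = w \<otimes> (x \<otimes> y)"
      using wc xc y(1) minus_equality[of w "\<ominus> (w \<otimes> (x \<otimes> y))"] by simp
    then have "w = (w \<otimes> y) \<otimes> x"
      using wc xc y(1) by (simp add: m_ac)
    then show "w \<in> PIdl x"
      using wc y(1) unfolding cgenideal_def by blast
  qed
qed

lemma (in cring) complete_if_reduced:
  assumes red: "nilradical R = {\<zero>}"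
    and reg: "regular_graph r (with_proj (nil_graph R))"
  shows "complete_graph (with_proj (nil_graph R))"
proof (rule complete_nil_graphI)
  fix I J assume IJ: "I \<in> nil_vertices R" "J \<in> nil_vertices R" "I \<noteq> J"
  have "I \<inter> J \<subseteq> {\<zero>}"
    using vertex_generated_by_nonzero_element[OF red reg] IJ by blast
  then show "I \<cdot> J \<subseteq> nilradical R"
    using ideal_prod_inter nil_verticesD(1) IJ red by blast
qed

theorem theorem5:
  fixes R :: "('a, 'b) ring_scheme" (structure) and r :: nat
  assumes "cring R"
    and "\<one> \<noteq> \<zero>"
    and "\<not> domain R"
    and "regular_graph r (with_proj (nil_graph R))"
  shows "complete_graph (with_proj (nil_graph R))"
proof -
  interpret cring R by fact
  have "\<zero> [^] (1::nat) = \<zero>"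
    by simp
  then have "\<zero> \<in> nilradical R"
    unfolding nilradical_def by blast
  then consider "nilradical R = {\<zero>}" | a where "a \<in> nilradical R" "a \<noteq> \<zero>"
    by blast
  then show ?thesis
    using complete_if_reduced complete_if_not_reduced assms(2,4) by cases blast+
qed

end
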